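(* For all real values of the parameters $a_{1,1},a_{1,3},a_{1,5},a_{3,1},a_{3,3},a_{3,5}$ (and of $\alpha$, subject to the restrictions indicated), each of the following 7-dimensional real Lie algebras, given by its structure equations $(de^1,\dots,de^7)$, admits the closed $\mathrm{G}_2$-structure given by the 3-form $$\varphi=e^{127}+e^{347}+e^{567}+e^{135}-e^{146}-e^{236}-e^{245}:$$ 1. $(\mathfrak{e}(1,1)\oplus\mathfrak{e}(1,1))\oplus_D\mathbb{R}e_7=(0,\ 0,\ -e^{14}+a_{3,3}e^{37},\ -e^{13}+a_{3,3}e^{47},\ e^{25}-a_{3,3}e^{57},\ -e^{26}-a_{3,3}e^{67},\ 0)$; 2. $(\mathfrak{g}_{5,1}\oplus\mathbb{R})\oplus_D\mathbb{R}e_7=(0,\ 0,\ a_{1,3}e^{17}+a_{3,5}e^{57},\ e^{15}+a_{1,3}e^{27}+a_{3,5}e^{67},\ a_{1,5}e^{17}+a_{3,5}e^{37},\ e^{13}+a_{1,5}e^{27}+a_{3,5}e^{47},\ 0)$; 3. $(\mathfrak{g}_{5,7}^{-1,-1,1}\oplus\mathbb{R})\oplus_D\mathbb{R}e_7=(-e^{15}+a_{1,1}e^{17}+a_{3,1}e^{37},\ e^{25}+a_{1,1}e^{27}+a_{3,1}e^{47},\ -e^{35}+a_{1,3}e^{17}-a_{1,1}e^{37},\ e^{45}+a_{1,3}e^{27}-a_{1,1}e^{47},\ 0,\ 0,\ 0)$; 4. $(\mathfrak{g}_{5,17}^{\alpha,-\alpha,1}\oplus\mathbb{R})\oplus_D\mathbb{R}e_7=(\alpha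 e^{15}+e^{35}-a_{1,3}e^{37},\ -\alpha e^{25}+e^{45}-a_{1,3}e^{47},\ -e^{15}+\alpha e^{35}+a_{1,3}e^{17},\ -e^{25}-\alpha e^{45}+a_{1,3}e^{27},\ 0,\ 0,\ 0)$, with $\alpha\ge0$; 5. $\mathfrak{g}_{6,N3}\oplus_D\mathbb{R}e_7=(\tfrac{a_{1,3}}2e^{37}-a_{1,5}e^{57},\ e^{35}+\tfrac{a_{1,3}}2e^{47}-a_{1,5}e^{67},\ a_{1,3}e^{17}+2a_{3,5}e^{57},\ 2e^{15}+a_{1,3}e^{27}+2a_{3,5}e^{67},\ a_{1,5}e^{17}+a_{3,5}e^{37},\ e^{13}+a_{1,5}e^{27}+a_{3,5}e^{47},\ 0)$; 6. $\mathfrak{g}_{6,38}^0\oplus\mathbb{R}e_7=(2e^{36},\ 0,\ -e^{26},\ -e^{26}+e^{25},\ -e^{23}-e^{24},\ e^{23},\ 0)$; 7. $\mathfrak{g}_{6,54}^{0,-1}\oplus\mathbb{R}e_7=(e^{16}+e^{45},\ -e^{26},\ -e^{36}+e^{25},\ e^{46},\ 0,\ 0,\ 0)$; 8. $\mathfrak{g}_{6,118}^{0,-1,-1}\oplus_D\mathbb{R}e_7=(-e^{15}+e^{36}-a_{1,3}e^{37},\ e^{46}+e^{25}-a_{1,3}e^{47},\ -e^{16}-e^{35}+a_{1,3}e^{17},\ e^{45}-e^{26}+a_{1,3}e^{27},\ 0,\ 0,\ 0)$; 9. $A_{6,13}^{-\frac23,\frac13,-1}\oplus_D\mathbb{R}e_7=(-\tfrac14e^{14}-e^{23}+a_{1,1}e^{17},\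 \tfrac14e^{24}+a_{1,1}e^{27},\ -\tfrac12e^{34},\ 0,\ -\tfrac34e^{45}-a_{1,1}e^{57},\ \tfrac34e^{46}-a_{1,1}e^{67},\ 0)$; 10. $A_{6,54}^{2,1}\oplus_D\mathbb{R}e_7=(-\tfrac12e^{15}+a_{1,1}e^{17}+a_{3,1}e^{37},\ \tfrac12e^{25}+e^{16}+a_{1,1}e^{27}+a_{3,1}e^{47},\ -\tfrac12e^{35}+a_{1,3}e^{17}-a_{1,1}e^{37},\ \tfrac12e^{45}+e^{36}+a_{1,3}e^{27}-a_{1,1}e^{47},\ 0,\ -e^{56},\ 0)$; 11. $A_{6,70}^{\alpha,\frac\alpha2}\oplus_D\mathbb{R}e_7=(-\tfrac12e^{15}+\tfrac1\alpha e^{35}+e^{26}-a_{1,3}e^{37},\ \tfrac12e^{25}+\tfrac1\alpha e^{45}-a_{1,3}e^{47},\ -\tfrac1\alpha e^{15}-\tfrac12e^{35}+e^{46}+a_{1,3}e^{17},\ -\tfrac1\alpha e^{25}+\tfrac12e^{45}+a_{1,3}e^{27},\ 0,\ e^{56},\ 0)$, with $\alpha\ne0$; 12. $A_{6,71}^{-\frac32}\oplus\mathbb{R}e_7=(-\tfrac34e^{16},\ \tfrac34e^{26}+e^{35},\ \tfrac14e^{36}+e^{45},\ -\tfrac14e^{46}+e^{15},\ \tfrac12e^{56},\ 0,\ 0)$; 13. $N_{6,13}^{0,-2,0,-2}\oplus\mathbb{R}e_7=(-2\cdot3^{-1/6}e^{16},\ 2\cdot3^{-1/6}e^{26},\ 3^{-1/6}e^{36}+3^{5/6}e^{45},\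 0,\ 3^{-1/6}e^{34}+3^{-1/6}e^{56},\ 0,\ 0)$. That is, in each case the structure equations define a Lie algebra and $d\varphi=0$.
   Context: Notation: $\{e^1,\dots,e^7\}$ is a basis of the dual of the Lie algebra, $e^{ij}=e^i\wedge e^j$, $e^{ijk}=e^i\wedge e^j\wedge e^k$. A Lie algebra is described by its structure equations, i.e. the 7-tuple $(de^1,\dots,de^7)$, where $d$ is the Chevalley–Eilenberg differential, $d\alpha(X,Y)=-\alpha([X,Y])$ on 1-forms (such a tuple defines a Lie algebra exactly when $d^2=0$). The names such as $\mathfrak{g}_{6,N3}$ are only labels of 6-dimensional (or 5-dimensional) solvable Lie algebras; each algebra in the list is completely specified by the given structure equations. The notation $\mathfrak{h}\oplus_D\mathbb{R}e_7$ means the extension of the Lie algebra $\mathfrak{h}=\mathrm{span}(e_1,\dots,e_6)$ by a derivation $D$, with $[e_7,U]=D(U)$. A $\mathrm{G}_2$-structure on a 7-dimensional real Lie algebra is a 3-form that in some basis of the dual has the expression $e^{127}+e^{347}+e^{567}+e^{135}-e^{146}-e^{236}-e^{245}$; it is closed if its differential vanishes. *)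

theory Defs
  imports "HOL-Analysis.Analysis" "HOL-Library.Function_Algebras"
begin

text \<open>Forms on a real vector space are curried real-valued functions of their vector arguments;
  the pointwise \<open>+\<close>, \<open>-\<close> and \<open>0\<close> come from the library theory of function algebras.\<close>

type_synonym 'v form1 = "'v \<Rightarrow> real"
type_synonym 'v form2 = "'v \<Rightarrow> 'v \<Rightarrow> real"
type_synonym 'v form3 = "'v \<Rightarrow> 'v \<Rightarrow> 'v \<Rightarrow> real"
type_synonym 'v form4 = "'v \<Rightarrow> 'v \<Rightarrow> 'v \<Rightarrow> 'v \<Rightarrow> real"

definition scale2 :: "real \<Rightarrow> 'v form2 \<Rightarrow> 'v form2"  (infixr "*\<^sub>f" 75) where
  "c *\<^sub>f \<omega> = (\<lambda>X Y. c * \<omega> X Y)"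

text \<open>Wedge products of 1-forms, normalised without factorials, i.e. as the determinant of the
  values. This is the normalisation compatible with \<open>d\<alpha>(X,Y) = -\<alpha>([X,Y])\<close>.\<close>

definition wedge2 :: "'v form1 \<Rightarrow> 'v form1 \<Rightarrow> 'v form2" where
  "wedge2 \<alpha> \<beta> = (\<lambda>X Y. \<alpha> X * \<beta> Y - \<alpha> Y * \<beta> X)"

definition wedge3 :: "'v form1 \<Rightarrow> 'v form1 \<Rightarrow> 'v form1 \<Rightarrow> 'v form3" where
  "wedge3 \<alpha> \<beta> \<gamma> = (\<lambda>X Y Z.
     \<alpha> X * (\<beta> Y * \<gamma> Z - \<beta> Z * \<gamma> Y)
   - \<alpha> Y * (\<beta> X * \<gamma> Z - \<beta> Z * \<gamma> X)
   + \<alpha> Z * (\<beta> X * \<gamma> Y - \<beta> Y * \<gamma> X))"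

definition lie_bracket :: "('v::real_vector \<Rightarrow> 'v \<Rightarrow> 'v) \<Rightarrow> bool" where
  "lie_bracket br \<longleftrightarrow>
     bilinear br \<and> (\<forall>X. br X X = 0) \<and>
     (\<forall>X Y Z. br X (br Y Z) + br Y (br Z X) + br Z (br X Y) = 0)"

text \<open>The Chevalley--Eilenberg differential
  \<open>d\<omega>(X\<^sub>0,...,X\<^sub>k) = (\<Sum>i<j. (-1)\<^sup>i\<^sup>+\<^sup>j \<omega>([X\<^sub>i,X\<^sub>j], X\<^sub>0, ..., omit X\<^sub>i, ..., omit X\<^sub>j, ..., X\<^sub>k))\<close>
  on 1-forms and on 3-forms.\<close>

definition ce_d1 :: "('v \<Rightarrow> 'v \<Rightarrow> 'v) \<Rightarrow> 'v form1 \<Rightarrow> 'v form2" where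
  "ce_d1 br \<alpha> = (\<lambda>X Y. - \<alpha> (br X Y))"

definition ce_d3 :: "('v \<Rightarrow> 'v \<Rightarrow> 'v) \<Rightarrow> 'v form3 \<Rightarrow> 'v form4" where
  "ce_d3 br \<omega> = (\<lambda>X0 X1 X2 X3.
     - \<omega> (br X0 X1) X2 X3 + \<omega> (br X0 X2) X1 X3 - \<omega> (br X0 X3) X1 X2
     - \<omega> (br X1 X2) X0 X3 + \<omega> (br X1 X3) X0 X2 - \<omega> (br X2 X3) X0 X1)"

text \<open>Index types: in the numeral type \<open>7\<close> arithmetic is modulo 7, so the indices \<open>1, ..., 7\<close> are
  seven distinct elements exhausting the type (with \<open>7 = 0\<close>).\<close>

definition dual_basis :: "(7 \<Rightarrow> 'v::real_vector form1) \<Rightarrow> bool" where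
  "dual_basis f \<longleftrightarrow>
     (\<forall>i. linear (f i)) \<and>
     (\<forall>\<alpha>::'v form1. linear \<alpha> \<longrightarrow> (\<exists>!c::7 \<Rightarrow> real. \<alpha> = (\<lambda>X. \<Sum>i\<in>UNIV. c i * f i X)))"

definition g2_form :: "(7 \<Rightarrow> 'v form1) \<Rightarrow> 'v form3" where
  "g2_form f =
     wedge3 (f 1) (f 2) (f 7) + wedge3 (f 3) (f 4) (f 7) + wedge3 (f 5) (f 6) (f 7)
   + wedge3 (f 1) (f 3) (f 5) - wedge3 (f 1) (f 4) (f 6) - wedge3 (f 2) (f 3) (f 6)
   - wedge3 (f 2) (f 4) (f 5)"

definition G2_structure :: "'v::real_vector form3 \<Rightarrow> bool" where
  "G2_structure \<phi> \<longleftrightarrow> (\<exists>f. dual_basis f \<and> \<phi> = g2_form f)"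

definition closed_G2_structure :: "('v::real_vector \<Rightarrow> 'v \<Rightarrow> 'v) \<Rightarrow> 'v form3 \<Rightarrow> bool" where
  "closed_G2_structure br \<phi> \<longleftrightarrow> G2_structure \<phi> \<and> ce_d3 br \<phi> = 0"

text \<open>The underlying vector space of the algebras is \<open>\<real>\<^sup>7\<close>, with \<open>e i\<close> the \<open>i\<close>-th
  element of the basis dual to the standard one.\<close>

definition e :: "7 \<Rightarrow> (real^7) form1" where
  "e i = (\<lambda>X. X $ i)"

definition ee :: "7 \<Rightarrow> 7 \<Rightarrow> (real^7) form2" where
  "ee i j = wedge2 (e i) (e j)"

text \<open>\<open>S\<close> is the tuple \<open>(de\<^sup>1, ..., de\<^sup>7)\<close>. The bracket is unique: its \<open>i\<close>-th component is
  forced to be \<open>-S $ i\<close>.\<close>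

definition structure_equations ::
    "(real^7 \<Rightarrow> real^7 \<Rightarrow> real^7) \<Rightarrow> (real^7) form2 ^ 7 \<Rightarrow> bool" where
  "structure_equations br S \<longleftrightarrow> (\<forall>i. ce_d1 br (e i) = S $ i)"

definition Lie_algebra_with_closed_G2 :: "(real^7) form2 ^ 7 \<Rightarrow> (real^7) form3 \<Rightarrow> bool" where
  "Lie_algebra_with_closed_G2 S \<phi> \<longleftrightarrow>
     (\<exists>br. lie_bracket br \<and> structure_equations br S \<and> closed_G2_structure br \<phi>)"

end

(* Set [X,Y] = -sum_i de^i(X,Y) e_i, which has the prescribed structure equations. Up to sign,
   the i-th component of the Jacobi expression is d(de^i)(X,Y,Z), so both the Jacobi identity and
   d phi = 0 are identities in the exterior algebra. The Leibniz rule turns them into linear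
   combinations of monomials e^ijk and e^ijkl, which cancel after sorting the indices. *)

theory Submission
  imports Defs
begin

lemma exhaust_7:
  fixes i :: 7
  shows "i = 1 \<or> i = 2 \<or> i = 3 \<or> i = 4 \<or> i = 5 \<or> i = 6 \<or> i = 7"
proof (cases i)
  case (of_int z)
  \<comment> \<open>The representative \<open>z\<close> satisfies 0 \<le> z < 7; its value 0 stands
    for the index 7.\<close>
  then have "z = 0 \<or> z = 1 \<or> z = 2 \<or> z = 3 \<or> z = 4 \<or> z = 5 \<or> z = 6" by fastforce
  then show ?thesis using of_int by auto
qed

lemma forall_7: "(\<forall>i::7. P i) \<longleftrightarrow> P 1 \<and> P 2 \<and> P 3 \<and> P 4 \<and> P 5 \<and> P 6 \<and> P 7"
  by (metis exhaust_7)

text \<open>\<open>vector\<close> numbers its entries from 1 in steps of 1, and seven successive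
  indices modulo 7 are distinct, so no entry overwrites another.\<close>

lemma vector_7:
  "(vector [x1, x2, x3, x4, x5, x6, x7] :: 'a::zero^7) $ 1 = x1"
  "(vector [x1, x2, x3, x4, x5, x6, x7] :: 'a::zero^7) $ 2 = x2"
  "(vector [x1, x2, x3, x4, x5, x6, x7] :: 'a::zero^7) $ 3 = x3"
  "(vector [x1, x2, x3, x4, x5, x6, x7] :: 'a::zero^7) $ 4 = x4"
  "(vector [x1, x2, x3, x4, x5, x6, x7] :: 'a::zero^7) $ 5 = x5"
  "(vector [x1, x2, x3, x4, x5, x6, x7] :: 'a::zero^7) $ 6 = x6"
  "(vector [x1, x2, x3, x4, x5, x6, x7] :: 'a::zero^7) $ 7 = x7"
  by (simp_all add: vector_def)

text \<open>The coefficients are the values of \<alpha> on the standard basis vectors: expanding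
  \<open>X\<close> in that basis gives existence, and evaluating an expansion at
  \<open>axis i 1\<close> isolates \<open>c i\<close>, which gives uniqueness.\<close>

lemma dual_basis_e: "dual_basis e"
  unfolding dual_basis_def
proof (intro conjI allI impI)
  show "linear (e i)" for i
    unfolding e_def by (simp add: linear_iff)
next
  fix \<alpha> :: "(real^7) form1"
  assume lin: "linear \<alpha>"
  show "\<exists>!c. \<alpha> = (\<lambda>X. \<Sum>i\<in>UNIV. c i * e i X)"
  proof (intro ex1I)
    show "\<alpha> = (\<lambda>X. \<Sum>i\<in>UNIV. \<alpha> (axis i 1) * e i X)"
    proof
      fix X :: "real^7"
      have "\<alpha> X = \<alpha> (\<Sum>i\<in>UNIV. X $ i *s axis i 1)"
        by (simp add: basis_expansion)
      then show "\<alpha> X = (\<Sum>i\<in>UNIV. \<alpha> (axis i 1) * e i X)"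
        by (simp add: linear_sum[OF lin] linear_scale[OF lin] scalar_mult_eq_scaleR e_def mult.commute)
    qed
  next
    fix c
    assume c: "\<alpha> = (\<lambda>X. \<Sum>i\<in>UNIV. c i * e i X)"
    show "c = (\<lambda>i. \<alpha> (axis i 1))"
      by (simp add: c e_def axis_def fun_eq_iff if_distrib cong: if_cong)
  qed
qed

text \<open>The Chevalley--Eilenberg differential in degree 2, in which the Jacobi identity reads
  d(de^i) = 0.\<close>

definition ce_d2 :: "('v \<Rightarrow> 'v \<Rightarrow> 'v) \<Rightarrow> 'v form2 \<Rightarrow> 'v form3" where
  "ce_d2 br \<omega> = (\<lambda>X Y Z. - \<omega> (br X Y) Z + \<omega> (br X Z) Y - \<omega> (br Y Z) X)"

text \<open>Here and in \<open>wedge22\<close> the product is the signed sum over shuffles of the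
  arguments, which fits the determinant normalisation of \<open>wedge2\<close> and
  \<open>wedge3\<close>.\<close>

definition wedge21 :: "'v form2 \<Rightarrow> 'v form1 \<Rightarrow> 'v form3" where
  "wedge21 \<omega> \<gamma> = (\<lambda>X Y Z. \<omega> X Y * \<gamma> Z - \<omega> X Z * \<gamma> Y + \<omega> Y Z * \<gamma> X)"

definition wedge22 :: "'v form2 \<Rightarrow> 'v form2 \<Rightarrow> 'v form4" where
  "wedge22 \<omega> \<eta> = (\<lambda>X Y Z W. \<omega> X Y * \<eta> Z W - \<omega> X Z * \<eta> Y W + \<omega> X W * \<eta> Y Z
     + \<omega> Y Z * \<eta> X W - \<omega> Y W * \<eta> X Z + \<omega> Z W * \<eta> X Y)"

text \<open>The 4x4 determinant of the values, as its Laplace expansion by complementary 2x2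
  minors.\<close>

definition wedge4 :: "'v form1 \<Rightarrow> 'v form1 \<Rightarrow> 'v form1 \<Rightarrow> 'v form1 \<Rightarrow> 'v form4" where
  "wedge4 \<alpha> \<beta> \<gamma> \<delta> = wedge22 (wedge2 \<alpha> \<beta>) (wedge2 \<gamma> \<delta>)"

text \<open>Associativity of the wedge product. Like the rules below it is stated at explicit
  arguments, so that identities of forms become identities of reals with the values of monomials as
  atoms.\<close>

lemma wedge21_wedge2: "wedge21 (wedge2 \<alpha> \<beta>) \<gamma> X Y Z = wedge3 \<alpha> \<beta> \<gamma> X Y Z"
  by (simp add: wedge21_def wedge2_def wedge3_def algebra_simps)

lemma wedge22_wedge2: "wedge22 (wedge2 \<alpha> \<beta>) (wedge2 \<gamma> \<delta>) X Y Z W = wedge4 \<alpha> \<beta> \<gamma> \<delta> X Y Z W"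
  by (simp add: wedge4_def)

text \<open>The Leibniz rule, with the differentiated factor moved to the front; a 2-form passes a
  1-form without a sign.\<close>

lemma ce_d2_wedge2:
  "ce_d2 br (wedge2 \<alpha> \<beta>) X Y Z =
    wedge21 (ce_d1 br \<alpha>) \<beta> X Y Z - wedge21 (ce_d1 br \<beta>) \<alpha> X Y Z"
  by (simp add: ce_d2_def wedge2_def wedge21_def ce_d1_def algebra_simps)

text \<open>Again the Leibniz rule with the differential in front. Once the structure equations are
  substituted, linearity in the first factor leaves only products of two \<open>wedge2\<close>, that
  is, \<open>wedge4\<close>.\<close>

lemma ce_d3_wedge3:
  "ce_d3 br (wedge3 \<alpha> \<beta> \<gamma>) X Y Z W =
    wedge22 (ce_d1 br \<alpha>) (wedge2 \<beta> \<gamma>) X Y Z W - wedge22 (ce_d1 br \<beta>) (wedge2 \<alpha> \<gamma>) X Y Z W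
    + wedge22 (ce_d1 br \<gamma>) (wedge2 \<alpha> \<beta>) X Y Z W"
  by (simp add: ce_d3_def wedge3_def wedge2_def wedge22_def ce_d1_def algebra_simps)

lemma ce_d2_linear:
  "ce_d2 br 0 X Y Z = 0"
  "ce_d2 br (\<omega> + \<eta>) X Y Z = ce_d2 br \<omega> X Y Z + ce_d2 br \<eta> X Y Z"
  "ce_d2 br (\<omega> - \<eta>) X Y Z = ce_d2 br \<omega> X Y Z - ce_d2 br \<eta> X Y Z"
  "ce_d2 br (- \<omega>) X Y Z = - ce_d2 br \<omega> X Y Z"
  "ce_d2 br (c *\<^sub>f \<omega>) X Y Z = c * ce_d2 br \<omega> X Y Z"
  by (simp_all add: ce_d2_def scale2_def algebra_simps)

lemma ce_d3_linear:
  "ce_d3 br (\<omega> + \<eta>) X Y Z W = ce_d3 br \<omega> X Y Z W + ce_d3 br \<eta> X Y Z W"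
  "ce_d3 br (\<omega> - \<eta>) X Y Z W = ce_d3 br \<omega> X Y Z W - ce_d3 br \<eta> X Y Z W"
  by (simp_all add: ce_d3_def)

lemma wedge21_linear:
  "wedge21 0 \<gamma> X Y Z = 0"
  "wedge21 (\<omega> + \<eta>) \<gamma> X Y Z = wedge21 \<omega> \<gamma> X Y Z + wedge21 \<eta> \<gamma> X Y Z"
  "wedge21 (\<omega> - \<eta>) \<gamma> X Y Z = wedge21 \<omega> \<gamma> X Y Z - wedge21 \<eta> \<gamma> X Y Z"
  "wedge21 (- \<omega>) \<gamma> X Y Z = - wedge21 \<omega> \<gamma> X Y Z"
  "wedge21 (c *\<^sub>f \<omega>) \<gamma> X Y Z = c * wedge21 \<omega> \<gamma> X Y Z"
  by (simp_all add: wedge21_def scale2_def algebra_simps)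

lemma wedge22_linear:
  "wedge22 0 \<theta> X Y Z W = 0"
  "wedge22 (\<omega> + \<eta>) \<theta> X Y Z W = wedge22 \<omega> \<theta> X Y Z W + wedge22 \<eta> \<theta> X Y Z W"
  "wedge22 (\<omega> - \<eta>) \<theta> X Y Z W = wedge22 \<omega> \<theta> X Y Z W - wedge22 \<eta> \<theta> X Y Z W"
  "wedge22 (- \<omega>) \<theta> X Y Z W = - wedge22 \<omega> \<theta> X Y Z W"
  "wedge22 (c *\<^sub>f \<omega>) \<theta> X Y Z W = c * wedge22 \<omega> \<theta> X Y Z W"
  by (simp_all add: wedge22_def scale2_def algebra_simps)

text \<open>Here and for \<open>wedge4\<close>, swapping adjacent factors only when they are out of
  order makes the rewriting terminate. Sorting brings repeated indices together, where the monomial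
  vanishes, and gives equal monomials the same syntactic form.\<close>

lemma wedge3_e_sort:
  "j < i \<Longrightarrow> wedge3 (e i) (e j) \<gamma> X Y Z = - wedge3 (e j) (e i) \<gamma> X Y Z"
  "j < i \<Longrightarrow> wedge3 \<alpha> (e i) (e j) X Y Z = - wedge3 \<alpha> (e j) (e i) X Y Z"
  "wedge3 \<alpha> \<alpha> \<gamma> X Y Z = 0"
  "wedge3 \<alpha> \<gamma> \<gamma> X Y Z = 0"
  by (simp_all add: wedge3_def algebra_simps)

lemma wedge4_e_sort:
  "j < i \<Longrightarrow> wedge4 (e i) (e j) \<gamma> \<delta> X Y Z W = - wedge4 (e j) (e i) \<gamma> \<delta> X Y Z W"
  "j < i \<Longrightarrow> wedge4 \<alpha> (e i) (e j) \<delta> X Y Z W = - wedge4 \<alpha> (e j) (e i) \<delta> X Y Z W"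
  "j < i \<Longrightarrow> wedge4 \<alpha> \<beta> (e i) (e j) X Y Z W = - wedge4 \<alpha> \<beta> (e j) (e i) X Y Z W"
  "wedge4 \<alpha> \<alpha> \<gamma> \<delta> X Y Z W = 0"
  "wedge4 \<alpha> \<beta> \<beta> \<delta> X Y Z W = 0"
  "wedge4 \<alpha> \<beta> \<gamma> \<gamma> X Y Z W = 0"
  by (simp_all add: wedge4_def wedge22_def wedge2_def algebra_simps)

text \<open>The last three facts decide the order of the indices; since \<open>7 = 0\<close>, the index \<open>7\<close> is the
  smallest one.\<close>

lemmas exterior_simps = ee_def g2_form_def ce_d2_wedge2 ce_d3_wedge3 ce_d2_linear ce_d3_linear
  wedge21_linear wedge22_linear wedge21_wedge2 wedge22_wedge2 wedge3_e_sort wedge4_e_sort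
  less_bit1_def bit1.Rep_numeral bit1.Rep_1

text \<open>The condition on the entries of a tuple that makes the bracket read off from it bilinear
  with [X,X] = 0.\<close>

definition alternating2 :: "'v::real_vector form2 \<Rightarrow> bool" where
  "alternating2 \<omega> \<longleftrightarrow> bilinear \<omega> \<and> (\<forall>X. \<omega> X X = 0)"

lemma alternating2_intros:
  "alternating2 0"
  "alternating2 (ee i j)"
  "alternating2 \<omega> \<Longrightarrow> alternating2 (- \<omega>)"
  "alternating2 \<omega> \<Longrightarrow> alternating2 (c *\<^sub>f \<omega>)"
  "alternating2 \<omega> \<Longrightarrow> alternating2 \<eta> \<Longrightarrow> alternating2 (\<omega> + \<eta>)"
  "alternating2 \<omega> \<Longrightarrow> alternating2 \<eta> \<Longrightarrow> alternating2 (\<omega> - \<eta>)"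
  unfolding alternating2_def bilinear_def linear_iff
  by (auto simp: scale2_def ee_def wedge2_def e_def algebra_simps)

text \<open>The assumptions \<open>d2\<close> and \<open>d3\<close> know the bracket only through
  its structure equations, so they can be checked by exterior calculus alone; the explicit bracket
  stays inside this proof.\<close>

lemma Lie_algebra_with_closed_G2I:
  fixes S :: "(real^7) form2 ^ 7"
  assumes alt: "\<And>i. alternating2 (S $ i)"
    and d2: "\<And>br i. structure_equations br S \<Longrightarrow> ce_d2 br (S $ i) = 0"
    and d3: "\<And>br. structure_equations br S \<Longrightarrow> ce_d3 br (g2_form e) = 0"
  shows "Lie_algebra_with_closed_G2 S (g2_form e)"
proof -
  define br :: "real^7 \<Rightarrow> real^7 \<Rightarrow> real^7" where "br X Y = (\<chi> i. - (S $ i) X Y)" for X Y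
  have se: "structure_equations br S"
    by (simp add: structure_equations_def ce_d1_def e_def br_def)
  have lin: "bilinear (S $ i)" for i using alt by (simp add: alternating2_def)
  \<comment> \<open>Polarisation: expand the value at the pair (X + Y, X + Y).\<close>
  have anti: "(S $ i) Y X = - (S $ i) X Y" for i X Y
  proof -
    have "(S $ i) (X + Y) (X + Y) = 0" "(S $ i) X X = 0" "(S $ i) Y Y = 0"
      using alt by (auto simp: alternating2_def)
    then show ?thesis
      by (simp add: bilinear_ladd[OF lin] bilinear_radd[OF lin])
  qed
  have "bilinear br"
    unfolding bilinear_def linear_iff
    by (simp add: br_def vec_eq_iff bilinear_ladd[OF lin] bilinear_radd[OF lin]
        bilinear_lmul[OF lin] bilinear_rmul[OF lin])
  moreover have "br X X = 0" for X
    using alt by (simp add: br_def vec_eq_iff alternating2_def)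
  moreover have "br X (br Y Z) + br Y (br Z X) + br Z (br X Y) = 0" for X Y Z
  proof -
    \<comment> \<open>The minus sign in \<open>br\<close> is absorbed by exchanging the arguments.
      This puts the inner bracket first, as in \<open>ce_d2\<close>.\<close>
    have swap: "br U V $ i = (S $ i) V U" for U V i
      by (simp add: br_def anti[of _ U V])
    have "br Z X = - br X Z"
      by (simp add: br_def vec_eq_iff anti[of _ X Z])
    then have "(br X (br Y Z) + br Y (br Z X) + br Z (br X Y)) $ i = - ce_d2 br (S $ i) X Y Z" for i
      by (simp add: swap ce_d2_def bilinear_lneg[OF lin])
    then show ?thesis
      using d2[OF se] by (simp add: vec_eq_iff)
  qed
  ultimately show ?thesis
    using se d3[OF se] dual_basis_e
    unfolding Lie_algebra_with_closed_G2_def lie_bracket_def closed_G2_structure_def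
      G2_structure_def by blast
qed

text \<open>The same criterion for an explicit tuple. The seven equations for \<open>ce_d1\<close>
  serve as rewrite rules, and all closedness conditions form a single goal at fixed
  arguments.\<close>

lemma Lie_algebra_with_closed_G2_vectorI:
  assumes alt: "alternating2 s1" "alternating2 s2" "alternating2 s3" "alternating2 s4"
    "alternating2 s5" "alternating2 s6" "alternating2 s7"
    and d: "\<And>br X Y Z W. \<lbrakk>ce_d1 br (e 1) = s1; ce_d1 br (e 2) = s2; ce_d1 br (e 3) = s3;
       ce_d1 br (e 4) = s4; ce_d1 br (e 5) = s5; ce_d1 br (e 6) = s6; ce_d1 br (e 7) = s7\<rbrakk> \<Longrightarrow>
       ce_d2 br s1 X Y Z = 0 \<and> ce_d2 br s2 X Y Z = 0 \<and> ce_d2 br s3 X Y Z = 0 \<and>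
       ce_d2 br s4 X Y Z = 0 \<and> ce_d2 br s5 X Y Z = 0 \<and> ce_d2 br s6 X Y Z = 0 \<and>
       ce_d2 br s7 X Y Z = 0 \<and> ce_d3 br (g2_form e) X Y Z W = 0"
  shows "Lie_algebra_with_closed_G2 (vector [s1, s2, s3, s4, s5, s6, s7]) (g2_form e)"
proof (rule Lie_algebra_with_closed_G2I)
  let ?S = "vector [s1, s2, s3, s4, s5, s6, s7] :: (real^7) form2 ^ 7"
  have "\<forall>i. alternating2 (?S $ i)"
    using alt by (simp add: forall_7 vector_7)
  then show "alternating2 (?S $ i)" for i ..
  fix br assume "structure_equations br ?S"
  then have *: "ce_d1 br (e 1) = s1" "ce_d1 br (e 2) = s2" "ce_d1 br (e 3) = s3"
       "ce_d1 br (e 4) = s4" "ce_d1 br (e 5) = s5" "ce_d1 br (e 6) = s6" "ce_d1 br (e 7) = s7"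
    by (simp_all add: structure_equations_def forall_7 vector_7)
  have "\<forall>i. ce_d2 br (?S $ i) = 0"
    using d[OF *] by (simp add: forall_7 vector_7 fun_eq_iff zero_fun_def)
  then show "ce_d2 br (?S $ i) = 0" for i ..
  show "ce_d3 br (g2_form e) = 0"
    using d[OF *] by (simp add: fun_eq_iff zero_fun_def)
qed

theorem proposition3p1:
  fixes a11 a13 a15 a31 a33 a35 \<alpha> :: real
  shows
   "(Lie_algebra_with_closed_G2 (vector [
       0, 0, -ee 1 4 + a33 *\<^sub>f ee 3 7, -ee 1 3 + a33 *\<^sub>f ee 4 7,
       ee 2 5 - a33 *\<^sub>f ee 5 7, -ee 2 6 - a33 *\<^sub>f ee 6 7, 0]) (g2_form e)) \<and>
    (Lie_algebra_with_closed_G2 (vector [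
       0, 0, a13 *\<^sub>f ee 1 7 + a35 *\<^sub>f ee 5 7,
       ee 1 5 + a13 *\<^sub>f ee 2 7 + a35 *\<^sub>f ee 6 7,
       a15 *\<^sub>f ee 1 7 + a35 *\<^sub>f ee 3 7,
       ee 1 3 + a15 *\<^sub>f ee 2 7 + a35 *\<^sub>f ee 4 7, 0]) (g2_form e)) \<and>
    (Lie_algebra_with_closed_G2 (vector [
       -ee 1 5 + a11 *\<^sub>f ee 1 7 + a31 *\<^sub>f ee 3 7,
       ee 2 5 + a11 *\<^sub>f ee 2 7 + a31 *\<^sub>f ee 4 7,
       -ee 3 5 + a13 *\<^sub>f ee 1 7 - a11 *\<^sub>f ee 3 7,
       ee 4 5 + a13 *\<^sub>f ee 2 7 - a11 *\<^sub>f ee 4 7, 0, 0, 0]) (g2_form e)) \<and>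
    (\<alpha> \<ge> 0 \<longrightarrow> Lie_algebra_with_closed_G2 (vector [
       \<alpha> *\<^sub>f ee 1 5 + ee 3 5 - a13 *\<^sub>f ee 3 7,
       -\<alpha> *\<^sub>f ee 2 5 + ee 4 5 - a13 *\<^sub>f ee 4 7,
       -ee 1 5 + \<alpha> *\<^sub>f ee 3 5 + a13 *\<^sub>f ee 1 7,
       -ee 2 5 - \<alpha> *\<^sub>f ee 4 5 + a13 *\<^sub>f ee 2 7, 0, 0, 0]) (g2_form e)) \<and>
    (Lie_algebra_with_closed_G2 (vector [
       (a13 / 2) *\<^sub>f ee 3 7 - a15 *\<^sub>f ee 5 7,
       ee 3 5 + (a13 / 2) *\<^sub>f ee 4 7 - a15 *\<^sub>f ee 6 7,
       a13 *\<^sub>f ee 1 7 + (2 * a35) *\<^sub>f ee 5 7,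
       2 *\<^sub>f ee 1 5 + a13 *\<^sub>f ee 2 7 + (2 * a35) *\<^sub>f ee 6 7,
       a15 *\<^sub>f ee 1 7 + a35 *\<^sub>f ee 3 7,
       ee 1 3 + a15 *\<^sub>f ee 2 7 + a35 *\<^sub>f ee 4 7, 0]) (g2_form e)) \<and>
    (Lie_algebra_with_closed_G2 (vector [
       2 *\<^sub>f ee 3 6, 0, -ee 2 6, -ee 2 6 + ee 2 5, -ee 2 3 - ee 2 4,
       ee 2 3, 0]) (g2_form e)) \<and>
    (Lie_algebra_with_closed_G2 (vector [
       ee 1 6 + ee 4 5, -ee 2 6, -ee 3 6 + ee 2 5, ee 4 6, 0, 0, 0]) (g2_form e)) \<and>
    (Lie_algebra_with_closed_G2 (vector [
       -ee 1 5 + ee 3 6 - a13 *\<^sub>f ee 3 7,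
       ee 4 6 + ee 2 5 - a13 *\<^sub>f ee 4 7,
       -ee 1 6 - ee 3 5 + a13 *\<^sub>f ee 1 7,
       ee 4 5 - ee 2 6 + a13 *\<^sub>f ee 2 7, 0, 0, 0]) (g2_form e)) \<and>
    (Lie_algebra_with_closed_G2 (vector [
       -(1/4) *\<^sub>f ee 1 4 - ee 2 3 + a11 *\<^sub>f ee 1 7,
       (1/4) *\<^sub>f ee 2 4 + a11 *\<^sub>f ee 2 7, -(1/2) *\<^sub>f ee 3 4,
       0, -(3/4) *\<^sub>f ee 4 5 - a11 *\<^sub>f ee 5 7,
       (3/4) *\<^sub>f ee 4 6 - a11 *\<^sub>f ee 6 7, 0]) (g2_form e)) \<and>
    (Lie_algebra_with_closed_G2 (vector [
       -(1/2) *\<^sub>f ee 1 5 + a11 *\<^sub>f ee 1 7 + a31 *\<^sub>f ee 3 7,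
       (1/2) *\<^sub>f ee 2 5 + ee 1 6 + a11 *\<^sub>f ee 2 7 + a31 *\<^sub>f ee 4 7,
       -(1/2) *\<^sub>f ee 3 5 + a13 *\<^sub>f ee 1 7 - a11 *\<^sub>f ee 3 7,
       (1/2) *\<^sub>f ee 4 5 + ee 3 6 + a13 *\<^sub>f ee 2 7 - a11 *\<^sub>f ee 4 7,
       0, -ee 5 6, 0]) (g2_form e)) \<and>
    (\<alpha> \<noteq> 0 \<longrightarrow> Lie_algebra_with_closed_G2 (vector [
       -(1/2) *\<^sub>f ee 1 5 + (1/\<alpha>) *\<^sub>f ee 3 5 + ee 2 6 - a13 *\<^sub>f ee 3 7,
       (1/2) *\<^sub>f ee 2 5 + (1/\<alpha>) *\<^sub>f ee 4 5 - a13 *\<^sub>f ee 4 7,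
       -(1/\<alpha>) *\<^sub>f ee 1 5 - (1/2) *\<^sub>f ee 3 5 + ee 4 6 + a13 *\<^sub>f ee 1 7,
       -(1/\<alpha>) *\<^sub>f ee 2 5 + (1/2) *\<^sub>f ee 4 5 + a13 *\<^sub>f ee 2 7,
       0, ee 5 6, 0]) (g2_form e)) \<and>
    (Lie_algebra_with_closed_G2 (vector [
       -(3/4) *\<^sub>f ee 1 6, (3/4) *\<^sub>f ee 2 6 + ee 3 5,
       (1/4) *\<^sub>f ee 3 6 + ee 4 5, -(1/4) *\<^sub>f ee 4 6 + ee 1 5,
       (1/2) *\<^sub>f ee 5 6, 0, 0]) (g2_form e)) \<and>
    (Lie_algebra_with_closed_G2 (vector [
       -(2 * (3 powr (-1/6))) *\<^sub>f ee 1 6,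
       (2 * (3 powr (-1/6))) *\<^sub>f ee 2 6,
       (3 powr (-1/6)) *\<^sub>f ee 3 6 + (3 powr (5/6)) *\<^sub>f ee 4 5, 0,
       (3 powr (-1/6)) *\<^sub>f ee 3 4 + (3 powr (-1/6)) *\<^sub>f ee 5 6, 0,
       0]) (g2_form e))"
proof -
  \<comment> \<open>Since 5/6 = 1 - 1/6, all coefficients of the last algebra become integer
    multiples of \<open>3 powr (-1/6)\<close>, so its identities cancel like those of a polynomial
    in one unknown.\<close>
  have "3 powr (5/6) = 3 powr (1 + (-1/6) :: real)"
    by simp
  also have "\<dots> = 3 * 3 powr (-1/6)"
    by (simp only: powr_add) simp
  finally have powr_eq: "3 powr (5/6) = (3 * 3 powr (-1/6) :: real)" .
  show ?thesis
    unfolding powr_eq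
    \<comment> \<open>For each algebra the syntax of the entries settles
      \<open>alternating2\<close>. In the remaining goal the first simplification expands everything
      into sorted monomials and the second collects their real coefficients, splitting
      quotients.\<close>
    by (intro conjI impI;
        rule Lie_algebra_with_closed_G2_vectorI;
        (intro alternating2_intros |
          (simp add: exterior_simps; simp add: algebra_simps add_divide_distrib diff_divide_distrib)))
qed

end
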